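(* Let $K$ be a triangulated manifold of dimension $n$, and assume that $(\alpha,\beta)$ is a bistellar pair of type $h$ in $K$. Then $f(\mathbf{bm}_\alpha K)=f(K)$ if and only if $n=2h$.
   Context: A triangulated manifold is a finite abstract simplicial complex whose geometric realization is a topological manifold. For an $n$-dimensional simplicial complex $K$, $f(K)=(f_0,\dots,f_n)$ is its $f$-vector, where $f_i$ is the number of $i$-dimensional simplices. $\mathrm{Link}_K\alpha=\{\alpha'\in K\mid\alpha\cup\alpha'\in K,\ \alpha\cap\alpha'=\emptyset\}$. An ordered pair $(\alpha,\beta)$ is a bistellar pair of type $h$ in $K$ if $\alpha\in K$ is an $(n-h)$-simplex with $\mathrm{Link}_K\alpha=\partial\beta$ for a simplex $\beta\notin K$ (so $\dim\beta=h$; for $h=0$, $\beta$ is a new vertex). The bistellar $h$-move at $\alpha$ is $\mathbf{bm}_\alpha K=(K\setminus(\alpha*\partial\beta))\cup(\partial\alpha*\beta)$, where $*$ is the join. *)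

theory Defs
  imports "HOL-Analysis.Analysis"
begin

text \<open>A simplex is the finite set of its vertices. Every complex contains the empty simplex,
  of dimension -1; with this convention the link of a facet and the boundary of a vertex are
  both \<open>{{}}\<close>, and \<open>{{}}\<close> is the unit of the join.\<close>

definition finite_simplicial_complex :: "'a set set \<Rightarrow> bool" where
  "finite_simplicial_complex K \<longleftrightarrow>
     finite K \<and> {} \<in> K \<and> (\<forall>\<sigma>\<in>K. finite \<sigma> \<and> (\<forall>\<tau>. \<tau> \<subseteq> \<sigma> \<longrightarrow> \<tau> \<in> K))"

definition simplex_dim :: "'a set \<Rightarrow> int" where
  "simplex_dim \<sigma> = int (card \<sigma>) - 1"

definition complex_dim :: "'a set set \<Rightarrow> int" where
  "complex_dim K = Max (simplex_dim ` K)"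

definition f_number :: "'a set set \<Rightarrow> nat \<Rightarrow> nat" where
  "f_number K i = card {\<sigma> \<in> K. simplex_dim \<sigma> = int i}"

definition f_vector :: "'a set set \<Rightarrow> nat list" where
  "f_vector K = map (f_number K) [0..<nat (complex_dim K + 1)]"

text \<open>Points of the realization are given by their barycentric coordinates. For a finite complex
  the product topology induces the usual topology.\<close>

definition geometric_realization :: "'a set set \<Rightarrow> ('a \<Rightarrow> real) topology" where
  "geometric_realization K = subtopology (powertop_real UNIV)
     {x. (\<forall>v. 0 \<le> x v) \<and> {v. x v \<noteq> 0} \<in> K \<and> (\<Sum>v\<in>{v. x v \<noteq> 0}. x v) = 1}"

definition locally_Euclidean :: "nat \<Rightarrow> 'b topology \<Rightarrow> bool" where
  "locally_Euclidean m X \<longleftrightarrow>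
     (\<forall>x\<in>topspace X. \<exists>U V. openin X U \<and> x \<in> U \<and> openin (Euclidean_space m) V \<and>
        subtopology X U homeomorphic_space subtopology (Euclidean_space m) V)"

text \<open>Manifolds have no boundary, and all their components have the same dimension.\<close>

definition topological_manifold :: "'b topology \<Rightarrow> bool" where
  "topological_manifold X \<longleftrightarrow>
     Hausdorff_space X \<and> second_countable X \<and> (\<exists>m. locally_Euclidean m X)"

definition triangulated_manifold :: "'a set set \<Rightarrow> bool" where
  "triangulated_manifold K \<longleftrightarrow>
     finite_simplicial_complex K \<and> topological_manifold (geometric_realization K)"

definition link :: "'a set set \<Rightarrow> 'a set \<Rightarrow> 'a set set" where
  "link K \<alpha> = {\<alpha>' \<in> K. \<alpha> \<union> \<alpha>' \<in> K \<and> \<alpha> \<inter> \<alpha>' = {}}"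

definition simplex_boundary :: "'a set \<Rightarrow> 'a set set" where
  "simplex_boundary \<sigma> = {\<tau>. \<tau> \<subset> \<sigma>}"

text \<open>The join is only ever applied to complexes with disjoint vertex sets. A simplex \<open>\<sigma>\<close> is
  regarded as the complex \<open>Pow \<sigma>\<close> of its faces.\<close>

definition complex_join :: "'a set set \<Rightarrow> 'a set set \<Rightarrow> 'a set set" where
  "complex_join K L = {\<sigma> \<union> \<tau> | \<sigma> \<tau>. \<sigma> \<in> K \<and> \<tau> \<in> L}"

text \<open>That \<open>\<beta>\<close> has dimension \<open>h\<close> is not imposed: it follows if \<open>K\<close> is a triangulated manifold.
  The condition \<open>\<alpha> \<noteq> {}\<close> amounts to \<open>h \<le> complex_dim K\<close>.\<close>

definition bistellar_pair :: "'a set set \<Rightarrow> nat \<Rightarrow> 'a set \<Rightarrow> 'a set \<Rightarrow> bool" where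
  "bistellar_pair K h \<alpha> \<beta> \<longleftrightarrow>
     \<alpha> \<in> K \<and> \<alpha> \<noteq> {} \<and> simplex_dim \<alpha> = complex_dim K - int h \<and>
     finite \<beta> \<and> \<beta> \<noteq> {} \<and> \<beta> \<notin> K \<and> link K \<alpha> = simplex_boundary \<beta>"

definition bistellar_move :: "'a set \<Rightarrow> 'a set \<Rightarrow> 'a set set \<Rightarrow> 'a set set" where
  "bistellar_move \<alpha> \<beta> K =
     (K - complex_join (Pow \<alpha>) (simplex_boundary \<beta>)) \<union> complex_join (simplex_boundary \<alpha>) (Pow \<beta>)"

end

theory Submission
  imports Defs "HOL-Homology.Invariance_of_Domain"
begin

text \<open>Write \<open>a\<close> and \<open>b\<close> for the numbers of vertices of \<open>\<alpha>\<close> and \<open>\<beta>\<close>. The move deletes the simplices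
  \<open>\<alpha> \<union> \<tau>\<close> with \<open>\<tau> \<subset> \<beta>\<close> and adds the simplices \<open>\<beta> \<union> \<tau>\<close> with \<open>\<tau> \<subset> \<alpha>\<close>. If \<open>a = b\<close>, then both
  families have the same number of members of each size. If \<open>a \<noteq> b\<close>, then exactly one of the two
  families contains a simplex with \<open>min a b\<close> vertices, and it contains only one. So the
  \<open>f\<close>-vector is preserved iff \<open>a = b\<close>, and \<open>a = n - h + 1\<close>.

  That \<open>b = h + 1\<close> amounts to the purity of a triangulated manifold: the relative interior of a
  maximal simplex is open in the realization, so by invariance of domain its dimension is that of
  the manifold.\<close>

section \<open>Purity of triangulated manifolds\<close>

text \<open>If \<open>n < m\<close>, invariance of domain would make the image of \<open>U\<close>
  open in \<open>Euclidean_space m\<close>, although it lies in a proper coordinate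
  subspace.\<close>

lemma continuous_injection_Euclidean_space_dim_le:
  assumes U: "openin (Euclidean_space m) U" "U \<noteq> {}"
    and f: "continuous_map (subtopology (Euclidean_space m) U) (Euclidean_space n) f"
    and inj: "inj_on f U"
  shows "m \<le> n"
proof (rule ccontr)
  assume "\<not> m \<le> n"
  then have nm: "n < m" by simp
  have sub: "f ` U \<subseteq> topspace (Euclidean_space n)"
    using continuous_map_image_subset_topspace[OF f] openin_subset[OF U(1)] by auto
  \<comment> \<open>Points of \<open>Euclidean_space n\<close> are sequences vanishing from index
    \<open>n\<close> on, so the smaller space is literally a subspace of the larger one.\<close>
  have "Euclidean_space n = subtopology (Euclidean_space m) (topspace (Euclidean_space n))"
    by (metis Euclidean_space_def nm less_imp_le inf.absorb_iff2 subset_Euclidean_space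
        subtopology_subtopology topspace_Euclidean_space)
  then have "continuous_map (subtopology (Euclidean_space m) U) (Euclidean_space m) f"
    using f by (metis continuous_map_in_subtopology)
  then have op: "openin (Euclidean_space m) (f ` U)"
    using invariance_of_domain_Euclidean_space U(1) inj by blast
  obtain y where y: "y \<in> f ` U" using U(2) by blast
  have y0: "y i = 0" if "i \<ge> n" for i
    using y sub that by (auto simp: topspace_Euclidean_space)
  \<comment> \<open>The line through \<open>y\<close> in direction \<open>n\<close>. It leaves the
    coordinate subspace except at \<open>t = 0\<close>, so it pulls the open image back to a single
    point of the real line.\<close>
  define c where "c = (\<lambda>t::real. \<lambda>i. if i < m then (if i = n then t else y i) else 0)"
  have "continuous_map euclideanreal (Euclidean_space m) c"
    unfolding c_def continuous_map_componentwise_Euclidean_space by simp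
  from openin_continuous_map_preimage[OF this op] have "open {t. c t \<in> f ` U}" by simp
  moreover have "c t \<in> f ` U \<longleftrightarrow> t = 0" for t
  proof
    assume "c t \<in> f ` U"
    then have "c t n = 0" using sub by (auto simp: topspace_Euclidean_space)
    then show "t = 0" using nm by (simp add: c_def)
  next
    assume "t = 0"
    then have "c t = y" using y0 nm by (auto simp: c_def fun_eq_iff)
    then show "c t \<in> f ` U" using y by simp
  qed
  ultimately show False using not_open_singleton[of "0::real"] by simp
qed

section \<open>Coordinates on the realization and on the open simplex\<close>

lemma topspace_geometric_realization:
  "topspace (geometric_realization K) =
     {x. (\<forall>v. 0 \<le> x v) \<and> {v. x v \<noteq> 0} \<in> K \<and> (\<Sum>v\<in>{v. x v \<noteq> 0}. x v) = 1}"
  by (simp add: geometric_realization_def)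

lemma continuous_map_geometric_realization_coordinate:
  "continuous_map (geometric_realization K) euclideanreal (\<lambda>x. x v)"
  unfolding geometric_realization_def
  by (intro continuous_map_from_subtopology continuous_map_product_projection) simp

text \<open>For a maximal simplex \<sigma> of \<open>K\<close> this open star is the relative
  interior of \<sigma>; it is used in that case.\<close>

lemma openin_geometric_realization_open_star:
  assumes "finite \<sigma>"
  shows "openin (geometric_realization K) {x \<in> topspace (geometric_realization K). \<forall>v\<in>\<sigma>. 0 < x v}"
  using assms
proof (induction \<sigma>)
  case (insert w \<sigma>)
  have "openin (geometric_realization K) {x \<in> topspace (geometric_realization K). x w \<in> {0<..}}"
    by (rule openin_continuous_map_preimage[OF continuous_map_geometric_realization_coordinate])
      simp
  from openin_Int[OF this insert.IH] show ?case
    by (rule back_subst[of "openin _"]) auto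
qed simp

lemma continuous_map_Euclidean_space_coordinate:
  "continuous_map (Euclidean_space k) euclideanreal (\<lambda>y. y i)"
  unfolding Euclidean_space_def
  by (intro continuous_map_from_subtopology continuous_map_product_projection) simp

text \<open>The interior of a \<open>k\<close>-simplex in \<open>k\<close> of its
  \<open>k + 1\<close> barycentric coordinates. The bound on the sum expresses positivity of the
  remaining one.\<close>

lemma openin_Euclidean_space_simplex:
  "openin (Euclidean_space k)
     {y \<in> topspace (Euclidean_space k). (\<forall>i<k. 0 < y i) \<and> (\<Sum>i<k. y i) < 1}"
proof -
  \<comment> \<open>The bound \<open>j\<close> is kept apart from the dimension \<open>k\<close>, so
    that the induction adds one inequality at a time in a fixed space.\<close>
  have pos: "openin (Euclidean_space k) {y \<in> topspace (Euclidean_space k). \<forall>i<j. 0 < y i}" for j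
  proof (induction j)
    case (Suc j)
    have "openin (Euclidean_space k) {y \<in> topspace (Euclidean_space k). y j \<in> {0<..}}"
      by (rule openin_continuous_map_preimage[OF continuous_map_Euclidean_space_coordinate])
        simp
    from openin_Int[OF this Suc.IH] show ?case
      by (rule back_subst[of "openin _"]) (auto simp: less_Suc_eq)
  qed simp
  have "openin (Euclidean_space k) {y \<in> topspace (Euclidean_space k). (\<Sum>i<k. y i) \<in> {..<1}}"
    by (intro openin_continuous_map_preimage[OF continuous_map_sum]
      continuous_map_Euclidean_space_coordinate) auto
  from openin_Int[OF pos this] show ?thesis
    by (rule back_subst[of "openin _"]) auto
qed

text \<open>Near the barycenter of \<sigma> the realization has two charts: one from the open
  simplex of dimension \<open>k\<close>, one from the manifold structure. The two transition maps
  give \<open>k \<le> m\<close> and \<open>m \<le> k\<close>.\<close>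

lemma card_maximal_simplex:
  fixes K :: "'a set set"
  assumes fin: "finite \<sigma>" and ne: "\<sigma> \<noteq> {}" and \<sigma>K: "\<sigma> \<in> K"
    and max: "\<And>\<tau>. \<tau> \<in> K \<Longrightarrow> \<sigma> \<subseteq> \<tau> \<Longrightarrow> \<tau> = \<sigma>"
    and loc: "locally_Euclidean m (geometric_realization K)"
  shows "card \<sigma> = Suc m"
proof -
  define X where "X = geometric_realization K"
  define k where "k = card \<sigma> - 1"
  have k: "card \<sigma> = Suc k"
    using fin ne by (simp add: k_def card_gt_0_iff)
  obtain e where e: "bij_betw e \<sigma> {..<Suc k}"
    using ex_bij_betw_finite_nat[OF fin] k by (auto simp: atLeast0LessThan)
  define e' where "e' = inv_into \<sigma> e"
  have ee': "e (e' i) = i" "e' i \<in> \<sigma>" if "i < Suc k" for i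
    using that e unfolding e'_def
    by (auto simp: bij_betw_def f_inv_into_f inv_into_into)
  have e'e: "e' (e v) = v" "e v < Suc k" if "v \<in> \<sigma>" for v
    using that e unfolding e'_def by (auto simp: bij_betw_def)
  define U0 where "U0 = {x \<in> topspace X. \<forall>v\<in>\<sigma>. 0 < x v}"
  define V0 where
    "V0 = {y \<in> topspace (Euclidean_space k). (\<forall>i<k. 0 < y i) \<and> (\<Sum>i<k. y i) < 1}"
  \<comment> \<open>\<open>p\<close> forgets the barycentric coordinate of the last vertex
    \<open>e' k\<close>; \<open>q\<close> restores it as one minus the sum of the others.\<close>
  define p where "p = (\<lambda>x::'a \<Rightarrow> real. \<lambda>i. if i < k then x (e' i) else 0)"
  define q where "q = (\<lambda>y::nat \<Rightarrow> real. \<lambda>v. if v \<in> \<sigma> then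
    (if e v < k then y (e v) else 1 - (\<Sum>i<k. y i)) else 0)"
  have oU0: "openin X U0"
    unfolding U0_def X_def by (rule openin_geometric_realization_open_star[OF fin])
  have oV0: "openin (Euclidean_space k) V0"
    unfolding V0_def by (rule openin_Euclidean_space_simplex)
  have contp: "continuous_map X (Euclidean_space k) p"
    unfolding p_def X_def continuous_map_componentwise_Euclidean_space
    by (simp add: continuous_map_geometric_realization_coordinate)
  \<comment> \<open>The support of \<open>x\<close> is a simplex of \<open>K\<close> containing
    \<sigma>, so maximality makes it equal to \<sigma>.\<close>
  have U0: "{v. x v \<noteq> 0} = \<sigma> \<and> sum x \<sigma> = 1" if "x \<in> U0" for x
  proof -
    from that have x: "{v. x v \<noteq> 0} \<in> K" "(\<Sum>v\<in>{v. x v \<noteq> 0}. x v) = 1" "\<forall>v\<in>\<sigma>. 0 < x v"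
      by (auto simp: U0_def X_def topspace_geometric_realization)
    have "x v \<noteq> 0" if "v \<in> \<sigma>" for v using bspec[OF x(3) that] by simp
    then have "{v. x v \<noteq> 0} = \<sigma>" by (intro max[OF x(1)] subsetI CollectI)
    then show ?thesis using x(2) by simp
  qed
  have sum_\<sigma>: "(\<Sum>v\<in>\<sigma>. g v) = (\<Sum>i<k. g (e' i)) + g (e' k)" for g :: "'a \<Rightarrow> real"
  proof -
    have "(\<Sum>v\<in>\<sigma>. g v) = (\<Sum>i<Suc k. g (e' i))"
      by (rule sum.reindex_bij_witness[of _ e' e]) (use ee' e'e in auto)
    then show ?thesis by simp
  qed
  have injp: "inj_on p U0"
  proof (rule inj_onI)
    fix x y assume x: "x \<in> U0" and y: "y \<in> U0" and eq: "p x = p y"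
    have low: "x (e' i) = y (e' i)" if "i < k" for i
      using fun_cong[OF eq, of i] that by (simp add: p_def)
    moreover have "x (e' k) = y (e' k)"
      using U0[OF x] U0[OF y] sum_\<sigma>[of x] sum_\<sigma>[of y] low by simp
    ultimately have all: "x (e' i) = y (e' i)" if "i < Suc k" for i
      using that by (auto simp: less_Suc_eq)
    show "x = y"
    proof (rule ext)
      fix v
      have "v \<in> \<sigma> \<longleftrightarrow> x v \<noteq> 0" "v \<in> \<sigma> \<longleftrightarrow> y v \<noteq> 0"
        using conjunct1[OF U0[OF x]] conjunct1[OF U0[OF y]]
        by (simp_all only: set_eq_iff mem_Collect_eq)
      then show "x v = y v" using all[of "e v"] e'e[of v] by (cases "v \<in> \<sigma>") auto
    qed
  qed
  have qV0: "q y \<in> U0" if "y \<in> V0" for y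
  proof -
    have pos: "0 < q y v" if "v \<in> \<sigma>" for v
      using that \<open>y \<in> V0\<close> by (auto simp: V0_def q_def)
    then have supp: "{v. q y v \<noteq> 0} = \<sigma>" by (force simp: q_def)
    have "sum (q y) \<sigma> = (\<Sum>i<k. y i) + (1 - (\<Sum>i<k. y i))"
      unfolding sum_\<sigma> by (intro arg_cong2[where f = "(+)"] sum.cong) (auto simp: q_def ee')
    moreover have "0 \<le> q y v" for v
      using pos[of v] by (cases "v \<in> \<sigma>") (auto simp: q_def)
    ultimately show ?thesis
      using pos \<sigma>K by (auto simp: U0_def X_def topspace_geometric_realization supp)
  qed
  have pq: "p (q y) = y" if "y \<in> V0" for y
    using that by (auto simp: p_def q_def V0_def topspace_Euclidean_space ee' fun_eq_iff)
  have "continuous_map (Euclidean_space k) (powertop_real UNIV) q"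
  proof -
    have "continuous_map (Euclidean_space k) euclideanreal (\<lambda>y. q y v)" for v
      unfolding q_def
      by (cases "v \<in> \<sigma>"; cases "e v < k") (auto intro!: continuous_intros
          continuous_map_Euclidean_space_coordinate)
    then show ?thesis by (simp add: continuous_map_componentwise_UNIV)
  qed
  then have contq: "continuous_map (subtopology (Euclidean_space k) V0) X q"
    unfolding X_def geometric_realization_def continuous_map_in_subtopology
    using qV0 by (auto simp: U0_def X_def topspace_geometric_realization
        intro: continuous_map_from_subtopology)
  \<comment> \<open>The barycenter of \<sigma>: the coordinate that \<open>q\<close> restores is
    \<open>1 / real (Suc k)\<close> as well.\<close>
  define y0 where "y0 = (\<lambda>i. if i < k then 1 / real (Suc k) else 0)"
  have y0: "y0 \<in> V0"
    by (auto simp: y0_def V0_def topspace_Euclidean_space divide_simps)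
  have "q y0 \<in> topspace X" using qV0[OF y0] by (simp add: U0_def)
  then obtain U V where UV: "openin X U" "q y0 \<in> U" "openin (Euclidean_space m) V"
      "subtopology X U homeomorphic_space subtopology (Euclidean_space m) V"
    using loc unfolding locally_Euclidean_def X_def by blast
  then obtain f g where
    fg: "homeomorphic_maps (subtopology X U) (subtopology (Euclidean_space m) V) f g"
    by (auto simp: homeomorphic_space_def)
  have subs: "U \<subseteq> topspace X" "V \<subseteq> topspace (Euclidean_space m)"
    using UV by (auto dest: openin_subset)
  then have top: "topspace (subtopology X U) = U" "topspace (subtopology (Euclidean_space m) V) = V"
    by auto
  from fg have f: "continuous_map (subtopology X U) (subtopology (Euclidean_space m) V) f"
    and g: "continuous_map (subtopology (Euclidean_space m) V) (subtopology X U) g"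
    and gf: "\<And>x. x \<in> U \<Longrightarrow> g (f x) = x" and fg': "\<And>z. z \<in> V \<Longrightarrow> f (g z) = z"
    unfolding homeomorphic_maps_def top by auto
  \<comment> \<open>From the open simplex into the manifold chart: \<open>q\<close> followed by
    \<open>f\<close>, with left inverse \<open>p \<circ> g\<close> on \<open>W\<close>.\<close>
  have "k \<le> m"
  proof (rule continuous_injection_Euclidean_space_dim_le)
    define W where "W = {y \<in> V0. q y \<in> U}"
    have "openin (subtopology (Euclidean_space k) V0)
        {y \<in> topspace (subtopology (Euclidean_space k) V0). q y \<in> U}"
      by (rule openin_continuous_map_preimage[OF contq UV(1)])
    also have "{y \<in> topspace (subtopology (Euclidean_space k) V0). q y \<in> U} = W"
      using openin_subset[OF oV0] by (auto simp: W_def)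
    finally show "openin (Euclidean_space k) W" using oV0 by (rule openin_trans_full)
    show "W \<noteq> {}" using y0 UV by (auto simp: W_def)
    have "continuous_map (subtopology (Euclidean_space k) W) (subtopology X U) q"
      unfolding continuous_map_in_subtopology
      using continuous_map_from_subtopology_mono[OF contq, of W] by (auto simp: W_def)
    then have "continuous_map (subtopology (Euclidean_space k) W)
        (subtopology (Euclidean_space m) V) (f \<circ> q)"
      using f by (rule continuous_map_compose)
    then show "continuous_map (subtopology (Euclidean_space k) W) (Euclidean_space m) (f \<circ> q)"
      by (simp add: continuous_map_in_subtopology)
    show "inj_on (f \<circ> q) W"
      by (rule inj_on_inverseI[of _ "p \<circ> g"]) (auto simp: W_def gf pq)
  qed
  \<comment> \<open>In the other direction: \<open>g\<close> followed by \<open>p\<close>, on the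
    part of the chart that \<open>g\<close> sends into the relative interior of \<sigma>.\<close>
  moreover have "m \<le> k"
  proof (rule continuous_injection_Euclidean_space_dim_le)
    define W where "W = {z \<in> V. g z \<in> U0}"
    have gX: "continuous_map (subtopology (Euclidean_space m) V) X g"
      using g by (simp add: continuous_map_in_subtopology)
    have "openin (subtopology (Euclidean_space m) V)
        {z \<in> topspace (subtopology (Euclidean_space m) V). g z \<in> U0}"
      by (rule openin_continuous_map_preimage[OF gX oU0])
    then have "openin (subtopology (Euclidean_space m) V) W" unfolding top W_def .
    then show "openin (Euclidean_space m) W" using UV(3) by (rule openin_trans_full)
    have "f (q y0) \<in> V" using f UV(2) top unfolding continuous_map_def by blast
    then show "W \<noteq> {}" using gf[OF UV(2)] qV0[OF y0] by (auto simp: W_def)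
    have "continuous_map (subtopology (Euclidean_space m) W) X g"
      using continuous_map_from_subtopology_mono[OF gX, of W] by (auto simp: W_def)
    then show "continuous_map (subtopology (Euclidean_space m) W) (Euclidean_space k) (p \<circ> g)"
      using contp by (rule continuous_map_compose)
    have "inj_on g W" by (rule inj_on_inverseI[of _ f]) (auto simp: W_def fg')
    then show "inj_on (p \<circ> g) W"
      by (rule comp_inj_on) (rule inj_on_subset[OF injp], auto simp: W_def)
  qed
  ultimately show ?thesis using k by simp
qed

text \<open>A simplex of top dimension is maximal, so it has \<open>Suc m\<close> vertices for the
  local dimension \<open>m\<close>. This identifies \<open>m\<close> with \<open>n\<close>, and any
  other maximal simplex has \<open>Suc m\<close> vertices too.\<close>

lemma triangulated_manifold_pure:
  assumes K: "triangulated_manifold K" and n: "complex_dim K = int n"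
    and \<sigma>: "\<sigma> \<in> K" "\<sigma> \<noteq> {}" and max: "\<And>\<tau>. \<tau> \<in> K \<Longrightarrow> \<sigma> \<subseteq> \<tau> \<Longrightarrow> \<tau> = \<sigma>"
  shows "card \<sigma> = Suc n"
proof -
  from K have fin: "finite K" "K \<noteq> {}" and simp: "\<And>\<tau>. \<tau> \<in> K \<Longrightarrow> finite \<tau>"
    by (auto simp: triangulated_manifold_def finite_simplicial_complex_def)
  from K obtain m where loc: "locally_Euclidean m (geometric_realization K)"
    by (auto simp: triangulated_manifold_def topological_manifold_def)
  have "complex_dim K \<in> simplex_dim ` K"
    unfolding complex_dim_def using fin by (intro Max_in) auto
  then obtain \<rho> where \<rho>: "\<rho> \<in> K" "card \<rho> = Suc n"
    using n by (force simp: simplex_dim_def)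
  have "\<tau> = \<rho>" if "\<tau> \<in> K" "\<rho> \<subseteq> \<tau>" for \<tau>
  proof -
    have "simplex_dim \<tau> \<le> complex_dim K"
      unfolding complex_dim_def using fin that by (intro Max_ge) auto
    then show ?thesis
      using n \<rho> that simp by (intro card_seteq[symmetric]) (auto simp: simplex_dim_def)
  qed
  then have "card \<rho> = Suc m"
    using \<rho> simp loc by (intro card_maximal_simplex[of _ K]) auto
  moreover have "card \<sigma> = Suc m"
    using \<sigma> simp max loc by (intro card_maximal_simplex[of _ K]) auto
  ultimately show ?thesis using \<rho> by simp
qed

section \<open>Bistellar pairs and moves\<close>

text \<open>A common vertex is a proper face of \<beta>, since it lies in \<open>K\<close> and
  \<beta> does not. It would then belong to the link of \<alpha>, whose members avoid
  \<alpha>.\<close>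

lemma bistellar_pair_disjoint:
  assumes K: "finite_simplicial_complex K" and pair: "bistellar_pair K h \<alpha> \<beta>"
  shows "\<alpha> \<inter> \<beta> = {}"
proof (rule equals0I)
  fix v assume v: "v \<in> \<alpha> \<inter> \<beta>"
  have "{v} \<in> K"
    using K pair v by (auto simp: finite_simplicial_complex_def bistellar_pair_def)
  then have "{v} \<subset> \<beta>" using v pair by (auto simp: bistellar_pair_def)
  then have "{v} \<in> link K \<alpha>" using pair by (simp add: bistellar_pair_def simplex_boundary_def)
  then show False using v by (simp add: link_def)
qed

lemma bistellar_pair_join_mem:
  assumes "bistellar_pair K h \<alpha> \<beta>" and "\<tau> \<subset> \<beta>"
  shows "\<alpha> \<union> \<tau> \<in> K"
proof -
  have "\<tau> \<in> link K \<alpha>" using assms by (simp add: bistellar_pair_def simplex_boundary_def)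
  then show ?thesis by (simp add: link_def)
qed

text \<open>Joining \<alpha> with a facet of \<beta> gives a maximal simplex of \<open>K\<close>,
  whose size is known from purity. Solving for \<open>card \<beta>\<close> gives the second
  claim.\<close>

lemma bistellar_pair_card:
  assumes K: "triangulated_manifold K" and n: "complex_dim K = int n"
    and pair: "bistellar_pair K h \<alpha> \<beta>"
  shows "card \<alpha> + h = Suc n" and "card \<beta> = Suc h"
proof -
  have K': "finite_simplicial_complex K" using K by (simp add: triangulated_manifold_def)
  have \<alpha>: "finite \<alpha>" "\<alpha> \<noteq> {}"
    using K' pair by (auto simp: finite_simplicial_complex_def bistellar_pair_def)
  show a: "card \<alpha> + h = Suc n"
    using pair n by (simp add: bistellar_pair_def simplex_dim_def)
  have \<beta>: "finite \<beta>" "\<beta> \<noteq> {}" using pair by (auto simp: bistellar_pair_def)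
  have dj: "\<alpha> \<inter> \<beta> = {}" using bistellar_pair_disjoint[OF K' pair] .
  obtain v where v: "v \<in> \<beta>" using \<beta> by blast
  define \<sigma> where "\<sigma> = \<alpha> \<union> (\<beta> - {v})"
  have \<sigma>K: "\<sigma> \<in> K" unfolding \<sigma>_def using pair v by (intro bistellar_pair_join_mem) auto
  have max: "\<rho> = \<sigma>" if \<rho>: "\<rho> \<in> K" "\<sigma> \<subseteq> \<rho>" for \<rho>
  proof -
    \<comment> \<open>Removing \<alpha> leaves a member of the link, hence a proper subset of
      \<beta>. As it contains the facet \<open>\<beta> - {v}\<close>, it equals that facet.\<close>
    have "\<rho> - \<alpha> \<in> K" using \<rho> K' by (auto simp: finite_simplicial_complex_def)
    moreover have "\<alpha> \<union> (\<rho> - \<alpha>) = \<rho>" using \<rho> by (auto simp: \<sigma>_def)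
    ultimately have "\<rho> - \<alpha> \<in> link K \<alpha>" using \<rho> by (auto simp: link_def)
    then have "\<rho> - \<alpha> \<subset> \<beta>" using pair by (simp add: bistellar_pair_def simplex_boundary_def)
    moreover have "\<beta> - {v} \<subseteq> \<rho> - \<alpha>" using \<rho> dj by (auto simp: \<sigma>_def)
    ultimately have "\<rho> - \<alpha> = \<beta> - {v}" by blast
    then show ?thesis using \<rho> by (auto simp: \<sigma>_def)
  qed
  have "\<sigma> \<noteq> {}" using \<alpha> by (simp add: \<sigma>_def)
  then have "card \<sigma> = Suc n" by (rule triangulated_manifold_pure[OF K n \<sigma>K _ max])
  moreover have "card \<sigma> = card \<alpha> + (card \<beta> - 1)"
    unfolding \<sigma>_def using \<alpha> \<beta> dj v by (subst card_Un_disjoint) auto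
  moreover have "0 < card \<beta>" using \<beta> by (simp add: card_gt_0_iff)
  ultimately show "card \<beta> = Suc h" using a by linarith
qed

section \<open>Face counts before and after the move\<close>

text \<open>For disjoint \<alpha> and \<beta> these are the faces of the join of \<alpha> with the
  boundary of \<beta> that contain \<alpha>.\<close>

definition proper_extensions :: "'a set \<Rightarrow> 'a set \<Rightarrow> 'a set set" where
  "proper_extensions \<alpha> \<beta> = (\<lambda>\<tau>. \<alpha> \<union> \<tau>) ` simplex_boundary \<beta>"

lemma finite_simplex_boundary: "finite \<sigma> \<Longrightarrow> finite (simplex_boundary \<sigma>)"
  unfolding simplex_boundary_def by (rule finite_subset[of _ "Pow \<sigma>"]) auto

text \<open>The two joins of the move share the join of both boundaries, which lies in
  \<open>K\<close>. The move deletes it and puts it back, so only faces containing all of \<alpha>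
  or all of \<beta> change.\<close>

lemma bistellar_move_eq:
  assumes K: "finite_simplicial_complex K" and pair: "bistellar_pair K h \<alpha> \<beta>"
  shows "bistellar_move \<alpha> \<beta> K = (K - proper_extensions \<alpha> \<beta>) \<union> proper_extensions \<beta> \<alpha>"
proof -
  have dj: "\<alpha> \<inter> \<beta> = {}" by (rule bistellar_pair_disjoint[OF K pair])
  have mem: "\<sigma> \<union> \<tau> \<in> K" if "\<sigma> \<subseteq> \<alpha>" "\<tau> \<subset> \<beta>" for \<sigma> \<tau>
  proof -
    have "\<sigma> \<union> \<tau> \<subseteq> \<alpha> \<union> \<tau>" using that by blast
    then show ?thesis
      using bistellar_pair_join_mem[OF pair that(2)] K
      unfolding finite_simplicial_complex_def by blast
  qed
  show ?thesis
  proof (intro equalityI subsetI)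
    fix \<rho> assume "\<rho> \<in> bistellar_move \<alpha> \<beta> K"
    then consider "\<rho> \<in> K" "\<rho> \<notin> complex_join (Pow \<alpha>) (simplex_boundary \<beta>)"
      | "\<rho> \<in> complex_join (simplex_boundary \<alpha>) (Pow \<beta>)"
      by (auto simp: bistellar_move_def)
    then show "\<rho> \<in> (K - proper_extensions \<alpha> \<beta>) \<union> proper_extensions \<beta> \<alpha>"
    proof cases
      case 1
      then show ?thesis by (auto simp: proper_extensions_def complex_join_def)
    next
      case 2
      then obtain \<sigma> \<tau> where \<rho>: "\<rho> = \<sigma> \<union> \<tau>" "\<sigma> \<subset> \<alpha>" "\<tau> \<subseteq> \<beta>"
        by (auto simp: complex_join_def simplex_boundary_def)
      show ?thesis
      proof (cases "\<tau> = \<beta>")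
        case True
        then show ?thesis using \<rho> by (auto simp: proper_extensions_def simplex_boundary_def)
      next
        case False
        \<comment> \<open>Since \<tau> is disjoint from \<alpha> and \<sigma> is a proper face of
          \<alpha>, the simplex \<rho> misses a vertex of \<alpha>.\<close>
        have "\<rho> \<notin> proper_extensions \<alpha> \<beta>"
          using \<rho> dj by (auto simp: proper_extensions_def)
        then show ?thesis using \<rho> mem[of \<sigma> \<tau>] False by auto
      qed
    qed
  next
    fix \<rho> assume "\<rho> \<in> (K - proper_extensions \<alpha> \<beta>) \<union> proper_extensions \<beta> \<alpha>"
    then consider "\<rho> \<in> K" "\<rho> \<notin> proper_extensions \<alpha> \<beta>" | "\<rho> \<in> proper_extensions \<beta> \<alpha>" by blast
    then show "\<rho> \<in> bistellar_move \<alpha> \<beta> K"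
    proof cases
      case 1
      show ?thesis
      proof (cases "\<rho> \<in> complex_join (Pow \<alpha>) (simplex_boundary \<beta>)")
        case True
        then obtain \<sigma> \<tau> where \<rho>: "\<rho> = \<sigma> \<union> \<tau>" "\<sigma> \<subseteq> \<alpha>" "\<tau> \<subset> \<beta>"
          by (auto simp: complex_join_def simplex_boundary_def)
        \<comment> \<open>So \<rho> lies in the common part, which is deleted and added
          again.\<close>
        then have "\<sigma> \<subset> \<alpha>" using 1 by (auto simp: proper_extensions_def simplex_boundary_def)
        then show ?thesis using \<rho>
          by (auto simp: bistellar_move_def complex_join_def simplex_boundary_def)
      qed (use 1 in \<open>simp add: bistellar_move_def\<close>)
    next
      case 2
      then show ?thesis
        by (auto simp: proper_extensions_def bistellar_move_def complex_join_def Un_commute)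
    qed
  qed
qed

text \<open>By disjointness \<tau> can be recovered from \<open>\<alpha> \<union> \<tau>\<close>, so
  subsets of \<beta> are counted. The strict upper bound on \<open>s\<close> excludes \<beta>
  itself, the only subset of its size.\<close>

lemma card_proper_extensions:
  assumes "finite \<alpha>" "finite \<beta>" "\<alpha> \<inter> \<beta> = {}"
  shows "card {\<sigma> \<in> proper_extensions \<alpha> \<beta>. card \<sigma> = s} =
    (if card \<alpha> \<le> s \<and> s < card \<alpha> + card \<beta> then card \<beta> choose (s - card \<alpha>) else 0)"
proof -
  have card: "card (\<alpha> \<union> \<tau>) = card \<alpha> + card \<tau>" if "\<tau> \<subseteq> \<beta>" for \<tau>
    using that assms by (intro card_Un_disjoint) (auto intro: finite_subset)
  have eq: "{\<sigma> \<in> proper_extensions \<alpha> \<beta>. card \<sigma> = s} =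
      (\<union>) \<alpha> ` {\<tau>. \<tau> \<subset> \<beta> \<and> card \<alpha> + card \<tau> = s}"
    by (auto simp: proper_extensions_def simplex_boundary_def card psubset_imp_subset)
  have "inj_on ((\<union>) \<alpha>) {\<tau>. \<tau> \<subset> \<beta> \<and> card \<alpha> + card \<tau> = s}"
    using assms(3) by (intro inj_onI) blast
  then have "card {\<sigma> \<in> proper_extensions \<alpha> \<beta>. card \<sigma> = s} =
      card {\<tau>. \<tau> \<subset> \<beta> \<and> card \<alpha> + card \<tau> = s}"
    unfolding eq by (rule card_image)
  also have "{\<tau>. \<tau> \<subset> \<beta> \<and> card \<alpha> + card \<tau> = s} =
      (if card \<alpha> \<le> s \<and> s < card \<alpha> + card \<beta> then {\<tau>. \<tau> \<subseteq> \<beta> \<and> card \<tau> = s - card \<alpha>} else {})"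
  proof (cases "card \<alpha> \<le> s \<and> s < card \<alpha> + card \<beta>")
    case True
    then show ?thesis by (auto simp: psubset_eq)
  next
    case False
    have "card \<alpha> + card \<tau> \<noteq> s" if "\<tau> \<subset> \<beta>" for \<tau>
      using psubset_card_mono[OF assms(2) that] False by linarith
    then show ?thesis unfolding if_not_P[OF False] by blast
  qed
  finally show ?thesis using n_subsets[OF assms(2)] by simp
qed

text \<open>The deleted simplices lie in \<open>K\<close>; the added ones contain \<beta> and so lie
  outside \<open>K\<close>. The additive form avoids truncated subtraction of naturals.\<close>

lemma f_number_bistellar_move:
  assumes K: "finite_simplicial_complex K" and pair: "bistellar_pair K h \<alpha> \<beta>"
  shows "f_number (bistellar_move \<alpha> \<beta> K) i + card {\<sigma> \<in> proper_extensions \<alpha> \<beta>. card \<sigma> = Suc i} =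
    f_number K i + card {\<sigma> \<in> proper_extensions \<beta> \<alpha>. card \<sigma> = Suc i}"
proof -
  define R where "R = {\<sigma> \<in> proper_extensions \<alpha> \<beta>. card \<sigma> = Suc i}"
  define N where "N = {\<sigma> \<in> proper_extensions \<beta> \<alpha>. card \<sigma> = Suc i}"
  define F where "F = {\<sigma> \<in> K. card \<sigma> = Suc i}"
  have f: "f_number L i = card {\<sigma> \<in> L. card \<sigma> = Suc i}" for L :: "'a set set"
    unfolding f_number_def simplex_dim_def
    by (intro arg_cong[of _ _ card] Collect_cong) linarith
  have move: "{\<sigma> \<in> bistellar_move \<alpha> \<beta> K. card \<sigma> = Suc i} = (F - R) \<union> N"
    by (auto simp: bistellar_move_eq[OF K pair] R_def N_def F_def)
  have fin: "finite F" "finite N"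
    using K pair
    by (auto simp: F_def N_def proper_extensions_def finite_simplicial_complex_def
        finite_simplex_boundary bistellar_pair_def)
  have sub: "R \<subseteq> F"
    using bistellar_pair_join_mem[OF pair]
    by (auto simp: R_def F_def proper_extensions_def simplex_boundary_def)
  have "N \<inter> K = {}"
    using K pair
    by (auto simp: N_def proper_extensions_def finite_simplicial_complex_def bistellar_pair_def)
  then have "card ((F - R) \<union> N) = card (F - R) + card N"
    using fin by (intro card_Un_disjoint) (auto simp: F_def)
  moreover have "card (F - R) + card R = card F"
    using sub fin card_mono[OF fin(1) sub] finite_subset[OF sub fin(1)]
    by (simp add: card_Diff_subset)
  ultimately show ?thesis
    unfolding f move R_def[symmetric] N_def[symmetric] F_def[symmetric] by simp
qed

text \<open>The length of \<open>f_vector\<close> depends on \<open>complex_dim\<close>, so equal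
  face counts alone do not give equal lists. Here the deleted and the added simplices realize the
  same sizes, so the set of dimensions is unchanged.\<close>

lemma complex_dim_bistellar_move_middle:
  assumes K: "finite_simplicial_complex K" and pair: "bistellar_pair K h \<alpha> \<beta>"
    and eq: "card \<alpha> = card \<beta>"
  shows "complex_dim (bistellar_move \<alpha> \<beta> K) = complex_dim K"
proof -
  have fin: "finite \<alpha>" "finite \<beta>"
    using K pair by (auto simp: finite_simplicial_complex_def bistellar_pair_def)
  have dj: "\<alpha> \<inter> \<beta> = {}" by (rule bistellar_pair_disjoint[OF K pair])
  have cards: "card {\<sigma> \<in> proper_extensions \<alpha> \<beta>. card \<sigma> = s} =
      card {\<sigma> \<in> proper_extensions \<beta> \<alpha>. card \<sigma> = s}" for s
    using card_proper_extensions[OF fin dj] card_proper_extensions[OF fin(2,1)] dj eq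
    by (simp add: Int_commute)
  have finext: "finite (proper_extensions \<alpha> \<beta>)" "finite (proper_extensions \<beta> \<alpha>)"
    using fin by (auto simp: proper_extensions_def finite_simplex_boundary)
  have sizes: "card ` proper_extensions \<alpha> \<beta> = card ` proper_extensions \<beta> \<alpha>"
  proof -
    \<comment> \<open>A size occurs in a finite family iff its count is nonzero, so equal counts
      give equal sets of sizes.\<close>
    have "s \<in> card ` A \<longleftrightarrow> card {\<sigma> \<in> A. card \<sigma> = s} \<noteq> 0" if "finite A" for A :: "'a set set" and s
      using that by auto
    then show ?thesis
      unfolding set_eq_iff by (simp only: finext cards simp_thms)
  qed
  have "simplex_dim ` proper_extensions \<alpha> \<beta> = simplex_dim ` proper_extensions \<beta> \<alpha>"
    using arg_cong[OF sizes, of "image (\<lambda>c. int c - 1)"] by (simp add: simplex_dim_def image_image)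
  moreover have "proper_extensions \<alpha> \<beta> \<subseteq> K"
    using bistellar_pair_join_mem[OF pair]
    by (auto simp: proper_extensions_def simplex_boundary_def)
  ultimately have "simplex_dim ` bistellar_move \<alpha> \<beta> K = simplex_dim ` K"
    unfolding bistellar_move_eq[OF K pair] by (metis Diff_partition Un_commute image_Un)
  then show ?thesis by (simp add: complex_dim_def)
qed

section \<open>Comparison of the \<open>f\<close>-vectors\<close>

theorem proposition2p3:
  fixes K :: "'a set set" and \<alpha> \<beta> :: "'a set" and n h :: nat
  assumes "triangulated_manifold K"
    and "complex_dim K = int n"
    and "bistellar_pair K h \<alpha> \<beta>"
  shows "f_vector (bistellar_move \<alpha> \<beta> K) = f_vector K \<longleftrightarrow> n = 2 * h"
proof -
  have K: "finite_simplicial_complex K" using assms(1) by (simp add: triangulated_manifold_def)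
  note pair = assms(3)
  have card: "card \<alpha> + h = Suc n" "card \<beta> = Suc h"
    using bistellar_pair_card[OF assms] by auto
  have fin: "finite \<alpha>" "finite \<beta>" and ne: "\<alpha> \<noteq> {}"
    using K pair by (auto simp: finite_simplicial_complex_def bistellar_pair_def)
  have pos: "0 < card \<alpha>" "0 < card \<beta>" using fin ne card by (auto simp: card_gt_0_iff)
  have dj: "\<alpha> \<inter> \<beta> = {}" "\<beta> \<inter> \<alpha> = {}" using bistellar_pair_disjoint[OF K pair] by auto
  note f = f_number_bistellar_move[OF K pair, unfolded
      card_proper_extensions[OF fin dj(1)] card_proper_extensions[OF fin(2,1) dj(2)]]
  show ?thesis
  proof
    assume "n = 2 * h"
    then have eq: "card \<alpha> = card \<beta>" using card by simp
    have "f_number (bistellar_move \<alpha> \<beta> K) i = f_number K i" for i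
      using f[of i] by (auto simp: eq split: if_splits)
    then have "f_number (bistellar_move \<alpha> \<beta> K) = f_number K" by blast
    then show "f_vector (bistellar_move \<alpha> \<beta> K) = f_vector K"
      using complex_dim_bistellar_move_middle[OF K pair eq] by (simp add: f_vector_def)
  next
    assume vec: "f_vector (bistellar_move \<alpha> \<beta> K) = f_vector K"
    then have "length (f_vector (bistellar_move \<alpha> \<beta> K)) = length (f_vector K)" by simp
    \<comment> \<open>Each \<open>f\<close>-vector stops at the dimension of its own complex; equal
      lengths are what allow a comparison of entries up to \<open>n\<close>.\<close>
    then have "nat (complex_dim (bistellar_move \<alpha> \<beta> K) + 1) = Suc n"
      using assms(2) by (simp add: f_vector_def nat_add_distrib)
    then have num: "f_number (bistellar_move \<alpha> \<beta> K) i = f_number K i" if "i \<le> n" for i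
      using vec that assms(2) by (simp add: f_vector_def nat_add_distrib del: upt_Suc)
    have "card \<alpha> = card \<beta>"
    proof (cases "card \<alpha>" "card \<beta>" rule: linorder_cases)
      \<comment> \<open>In the dimension of \<alpha> the move deletes exactly \<alpha> and adds
        nothing, as all added simplices have at least \<open>card \<beta>\<close> vertices.\<close>
      case less
      have "card \<alpha> - 1 \<le> n" using pos card by linarith
      then show ?thesis
        using f[of "card \<alpha> - 1"] num[of "card \<alpha> - 1"] less pos by simp
    next
      \<comment> \<open>Symmetrically, in the dimension of \<beta> the move adds exactly \<beta> and
        deletes nothing.\<close>
      case greater
      have "card \<beta> - 1 \<le> n" using pos card by linarith
      then show ?thesis
        using f[of "card \<beta> - 1"] num[of "card \<beta> - 1"] greater pos by simp
    qed
    then show "n = 2 * h" using card by simp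
  qed
qed

end
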